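(* Let $(E,T,S,e)$ be a conditional expectation preserving system. Then $Sf=f$ for all $f\in R(T)$.
   Context: A conditional Riesz triple $(E,e,T)$ consists of a Dedekind complete Riesz space $E$, a weak order unit $e$ of $E$, and a conditional expectation operator $T$ on $E$, that is, a strictly positive order continuous linear projection $T:E\to E$ with $Te=e$ and Dedekind complete range $R(T)$. A conditional expectation preserving system is a 4-tuple $(E,T,S,e)$ where $(E,e,T)$ is a conditional Riesz triple and $S:E\to E$ is an order continuous Riesz (lattice) homomorphism with $Se=e$ and $TSf=Tf$ for all $f\in E$. *)

theory Defs
  imports "HOL-Analysis.Analysis" "HOL-Library.Lattice_Algebras"
begin

class riesz_space = ordered_real_vector + lattice_ab_group_add_abs

(* conditionally_complete_lattice: every nonempty set that is bounded above (below)
   has a supremum (infimum), which is exactly Dedekind completeness. *)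
class dedekind_complete_riesz_space = riesz_space + conditionally_complete_lattice

(* The same property for a subset R in its induced order: bounds and suprema are taken
   inside R. The condition on infima follows. It also makes R a lattice when R is the range
   of a positive linear operator, any two elements then having an upper bound in R. *)
definition dedekind_complete_on :: "'a::order set \<Rightarrow> bool" where
  "dedekind_complete_on R \<longleftrightarrow>
     (\<forall>A\<subseteq>R. A \<noteq> {} \<longrightarrow> (\<exists>u\<in>R. \<forall>a\<in>A. a \<le> u) \<longrightarrow>
        (\<exists>s\<in>R. (\<forall>a\<in>A. a \<le> s) \<and> (\<forall>u\<in>R. (\<forall>a\<in>A. a \<le> u) \<longrightarrow> s \<le> u)))"

definition weak_order_unit :: "'a::riesz_space \<Rightarrow> bool" where
  "weak_order_unit e \<longleftrightarrow> 0 \<le> e \<and> (\<forall>f. inf \<bar>f\<bar> e = 0 \<longrightarrow> f = 0)"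

definition decreases_to_zero :: "'a::dedekind_complete_riesz_space set \<Rightarrow> bool" where
  "decreases_to_zero D \<longleftrightarrow>
     D \<noteq> {} \<and> (\<forall>a\<in>D. \<forall>b\<in>D. \<exists>c\<in>D. c \<le> a \<and> c \<le> b) \<and> bdd_below D \<and> Inf D = 0"

(* Order convergence of a net f to l, nets being rendered as functions along a filter:
   there is a system D of dominating elements decreasing to 0 such that, for every d in D,
   the difference is eventually at most d in absolute value. *)
definition order_converges ::
    "('i \<Rightarrow> 'a::dedekind_complete_riesz_space) \<Rightarrow> 'a \<Rightarrow> 'i filter \<Rightarrow> bool" where
  "order_converges f l F \<longleftrightarrow>
     (\<exists>D. decreases_to_zero D \<and> (\<forall>d\<in>D. \<forall>\<^sub>F i in F. \<bar>f i - l\<bar> \<le> d))"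

(* Quantifying over filters on the space itself loses nothing: a function along F converges
   iff the identity converges along the image of F (see order_continuousD). *)
definition order_continuous ::
    "('a::dedekind_complete_riesz_space \<Rightarrow> 'b::dedekind_complete_riesz_space) \<Rightarrow> bool" where
  "order_continuous T \<longleftrightarrow>
     (\<forall>F l. order_converges (\<lambda>x. x) l F \<longrightarrow> order_converges T (T l) F)"

definition strictly_positive :: "('a::riesz_space \<Rightarrow> 'b::riesz_space) \<Rightarrow> bool" where
  "strictly_positive T \<longleftrightarrow> (\<forall>f\<ge>0. 0 \<le> T f) \<and> (\<forall>f>0. 0 < T f)"

definition riesz_homomorphism :: "('a::riesz_space \<Rightarrow> 'b::riesz_space) \<Rightarrow> bool" where
  "riesz_homomorphism S \<longleftrightarrow>
     linear S \<and> (\<forall>f g. S (sup f g) = sup (S f) (S g)) \<and> (\<forall>f g. S (inf f g) = inf (S f) (S g))"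

definition conditional_expectation_operator ::
    "'a::dedekind_complete_riesz_space \<Rightarrow> ('a \<Rightarrow> 'a) \<Rightarrow> bool" where
  "conditional_expectation_operator e T \<longleftrightarrow>
     linear T \<and> T \<circ> T = T \<and> strictly_positive T \<and> order_continuous T \<and>
     T e = e \<and> dedekind_complete_on (range T)"

definition conditional_riesz_triple ::
    "'a::dedekind_complete_riesz_space \<Rightarrow> ('a \<Rightarrow> 'a) \<Rightarrow> bool" where
  "conditional_riesz_triple e T \<longleftrightarrow> weak_order_unit e \<and> conditional_expectation_operator e T"

definition conditional_expectation_preserving_system ::
    "('a::dedekind_complete_riesz_space \<Rightarrow> 'a) \<Rightarrow> ('a \<Rightarrow> 'a) \<Rightarrow> 'a \<Rightarrow> bool" where
  "conditional_expectation_preserving_system T S e \<longleftrightarrow>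
     conditional_riesz_triple e T \<and>
     riesz_homomorphism S \<and> order_continuous S \<and> S e = e \<and> (\<forall>f. T (S f) = T f)"

lemma order_continuousD:
  assumes "order_continuous T" and "order_converges f l F"
  shows "order_converges (\<lambda>i. T (f i)) (T l) F"
proof -
  have "order_converges (\<lambda>x. x) l (filtermap f F)"
    using assms(2) by (simp add: order_converges_def eventually_filtermap)
  then have "order_converges T (T l) (filtermap f F)"
    using assms(1) by (auto simp: order_continuous_def)
  then show ?thesis
    by (simp add: order_converges_def eventually_filtermap)
qed

(* For positive linear operators this is the familiar description by downward directed sets. *)
lemma order_continuous_iff_decreasing:
  fixes T :: "'a::dedekind_complete_riesz_space \<Rightarrow> 'b::dedekind_complete_riesz_space"
  assumes lin: "linear T" and pos: "\<And>f. 0 \<le> f \<Longrightarrow> 0 \<le> T f"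
  shows "order_continuous T \<longleftrightarrow> (\<forall>D. decreases_to_zero D \<longrightarrow> decreases_to_zero (T ` D))"
proof -
  have mono: "T x \<le> T y" if "x \<le> y" for x y
    using pos[of "y - x"] that by (simp add: linear_diff[OF lin])
  have T0: "T 0 = 0"
    by (rule linear_0[OF lin])
  have nonneg: "0 \<le> d" if "decreases_to_zero D" "d \<in> D"
    for D :: "'x::dedekind_complete_riesz_space set" and d
    using that cInf_lower[of d D] by (auto simp: decreases_to_zero_def)
  show ?thesis
  proof (intro iffI allI impI)
    fix D :: "'a set"
    assume cont: "order_continuous T" and D: "decreases_to_zero D"
    define F where "F = (INF d\<in>D. principal {0..d})"
    have ev: "eventually P F \<longleftrightarrow> (\<exists>d\<in>D. \<forall>x\<in>{0..d}. P x)" for P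
      unfolding F_def
    proof (subst eventually_INF_base)
      show "D \<noteq> {}"
        using D by (simp add: decreases_to_zero_def)
      show "\<exists>x\<in>D. principal {0..x} \<le> inf (principal {0..a}) (principal {0..b})"
        if ab: "a \<in> D" "b \<in> D" for a b
      proof -
        obtain c where "c \<in> D" "c \<le> a" "c \<le> b"
          using D ab by (auto simp: decreases_to_zero_def)
        then show ?thesis
          by (intro bexI[of _ c]) (auto intro: order_trans)
      qed
    qed (simp add: eventually_principal)
    have "order_converges (\<lambda>x. x) 0 F"
      unfolding order_converges_def
      using D by (intro exI[of _ D]) (auto simp: ev)
    from order_continuousD[OF cont this] obtain D'
      where D': "decreases_to_zero D'" and "\<forall>d\<in>D'. eventually (\<lambda>x. \<bar>T x\<bar> \<le> d) F"
      by (auto simp: order_converges_def T0)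
    then have small: "\<exists>d\<in>D. T d \<le> d'" if "d' \<in> D'" for d'
    proof -
      have "\<exists>d\<in>D. \<forall>x\<in>{0..d}. \<bar>T x\<bar> \<le> d'"
        using \<open>\<forall>d\<in>D'. eventually (\<lambda>x. \<bar>T x\<bar> \<le> d) F\<close> that by (simp add: ev)
      then obtain d where d: "d \<in> D" and bound: "\<forall>x\<in>{0..d}. \<bar>T x\<bar> \<le> d'"
        by blast
      have "d \<in> {0..d}"
        using nonneg[OF D d] by simp
      then have "\<bar>T d\<bar> \<le> d'"
        using bound by blast
      then show ?thesis
        using d order_trans[OF abs_ge_self] by blast
    qed
    have ne: "T ` D \<noteq> {}"
      using D by (simp add: decreases_to_zero_def)
    have lb: "0 \<le> y" if "y \<in> T ` D" for y
      using that nonneg[OF D] pos by blast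
    then have bdd: "bdd_below (T ` D)"
      by (rule bdd_belowI)
    have "Inf (T ` D) \<le> Inf D'"
    proof (rule cInf_greatest)
      show "D' \<noteq> {}"
        using D' by (simp add: decreases_to_zero_def)
      show "Inf (T ` D) \<le> d'" if "d' \<in> D'" for d'
        using small[OF that] cInf_lower[OF _ bdd] by (blast intro: order_trans)
    qed
    then have "Inf (T ` D) = 0"
      using cInf_greatest[OF ne lb] D' by (auto simp: decreases_to_zero_def intro: antisym)
    moreover have "\<forall>a\<in>T ` D. \<forall>b\<in>T ` D. \<exists>c\<in>T ` D. c \<le> a \<and> c \<le> b"
    proof (clarify)
      fix a b assume "a \<in> D" "b \<in> D"
      then obtain c where "c \<in> D" "c \<le> a" "c \<le> b"
        using D by (auto simp: decreases_to_zero_def)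
      then show "\<exists>c\<in>T ` D. c \<le> T a \<and> c \<le> T b"
        using mono by blast
    qed
    ultimately show "decreases_to_zero (T ` D)"
      using ne bdd by (simp add: decreases_to_zero_def)
  next
    assume *: "\<forall>D. decreases_to_zero D \<longrightarrow> decreases_to_zero (T ` D)"
    have absT: "\<bar>T x\<bar> \<le> T \<bar>x\<bar>" for x
      using mono[OF abs_ge_self[of x]] mono[OF abs_ge_minus_self[of x]]
      by (auto simp: linear_neg[OF lin] intro: abs_leI)
    show "order_continuous T"
      unfolding order_continuous_def
    proof (intro allI impI)
      fix F :: "'a filter" and l
      assume "order_converges (\<lambda>x. x) l F"
      then obtain D where D: "decreases_to_zero D"
        and evD: "\<forall>d\<in>D. eventually (\<lambda>x. \<bar>x - l\<bar> \<le> d) F"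
        by (auto simp: order_converges_def)
      have "eventually (\<lambda>x. \<bar>T x - T l\<bar> \<le> T d) F" if "d \<in> D" for d
        using bspec[OF evD that]
      proof (rule eventually_mono)
        fix x assume "\<bar>x - l\<bar> \<le> d"
        then show "\<bar>T x - T l\<bar> \<le> T d"
          using order_trans[OF absT mono, of "x - l" d] by (simp add: linear_diff[OF lin])
      qed
      then show "order_converges T (T l) F"
        using * D by (auto simp: order_converges_def intro!: exI[of _ "T ` D"])
    qed
  qed
qed

end

theory Submission
  imports Defs
begin

text \<open>By strict positivity, \<open>R(T)\<close> is closed under the lattice operations. If \<open>u\<close> and \<open>v\<close>
  are disjoint positive elements of \<open>R(T)\<close>, then \<open>T (u \<sqinter> S v) \<le> u \<sqinter> T (S v) = u \<sqinter> v = 0\<close>, so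
  \<open>u\<close> and \<open>S v\<close> are disjoint. For \<open>0 \<le> f \<in> R(T)\<close>, applying this to the positive and negative parts
  of \<open>f - c e\<close> for \<open>c\<close> in a grid of mesh \<open>\<delta>\<close> and adding up the slices of \<open>f\<close> between consecutive
  grid points gives \<open>S f \<sqinter> n e \<le> f + \<delta> e\<close>. Letting \<open>\<delta> \<rightarrow> 0\<close> and \<open>n \<rightarrow> \<infinity>\<close> yields \<open>S f \<le> f\<close>, and
  since \<open>T (f - S f) = 0\<close>, equality holds.\<close>

text \<open>Archimedean property from Dedekind completeness: the multiples of \<open>y\<close> have
  a supremum \<open>s\<close>, and as a multiple plus \<open>y\<close> is again a multiple,
  \<open>s - y\<close> bounds them too.\<close>

lemma scaleR_bounded_imp_nonpos:
  fixes y b :: "'a::dedekind_complete_riesz_space"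
  assumes "\<And>n. real n *\<^sub>R y \<le> b"
  shows "y \<le> 0"
proof -
  define s where "s = (SUP n. real n *\<^sub>R y)"
  have bdd: "bdd_above (range (\<lambda>n. real n *\<^sub>R y))"
    using assms by (intro bdd_aboveI[of _ b]) auto
  have "real n *\<^sub>R y \<le> s - y" for n
  proof -
    have "real (Suc n) *\<^sub>R y \<le> s"
      unfolding s_def by (rule cSUP_upper[OF UNIV_I bdd])
    then show ?thesis
      by (simp add: scaleR_left_distrib le_diff_eq add.commute)
  qed
  then have "s \<le> s - y"
    unfolding s_def by (intro cSUP_least) auto
  then show ?thesis
    by (simp add: le_diff_eq)
qed

text \<open>\<open>inf (sup (y - p) 0) d\<close> is the slice of \<open>y\<close> between the levels
  \<open>p\<close> and \<open>p + d\<close>. Slices stack up because \<open>y\<close> is the sum of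
  \<open>inf y p\<close> and \<open>sup (y - p) 0\<close>.\<close>

lemma slice_eq_diff_inf:
  fixes y p d :: "'a::riesz_space"
  assumes "0 \<le> d"
  shows "inf y p + inf (sup (y - p) 0) d = inf y (p + d)"
proof -
  have "inf y p + sup (y - p) 0 = y"
  proof -
    have "p + sup (y - p) 0 = sup y p"
      by (simp add: add_sup_distrib_left)
    then have "inf y p + (p + sup (y - p) 0) = y + p"
      using add_eq_inf_sup[of y p] by (simp add: add.commute)
    then show ?thesis
      by (simp add: add.left_commute add.commute)
  qed
  then have "inf y p + inf (sup (y - p) 0) d = inf y (inf (y + d) (p + d))"
    by (simp add: add_inf_distrib_left add_inf_distrib_right)
  also have "\<dots> = inf y (p + d)"
    using assms by (simp add: inf.absorb1 flip: inf.assoc)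
  finally show ?thesis .
qed

text \<open>Think of functions: where \<open>b\<close> exceeds \<open>c\<close>, disjointness forces
  \<open>a\<close> to be at least \<open>c\<close>, so there the slice of \<open>a\<close> from
  \<open>c - d\<close> to \<open>c\<close> has full height \<open>d\<close>.\<close>

lemma slice_le_slice:
  fixes a b c d :: "'a::riesz_space"
  assumes "0 \<le> d" and disj: "inf (sup (b - c) 0) (sup (c - a) 0) = 0"
  shows "inf (sup (b - c) 0) d \<le> inf (sup (a - (c - d)) 0) d"
proof -
  let ?x = "inf (sup (b - c) 0) d" and ?v = "inf (sup (c - a) 0) d"
  have "inf ?x ?v = 0"
  proof (rule antisym)
    have "inf ?x ?v \<le> inf (sup (b - c) 0) (sup (c - a) 0)"
      by (intro inf_mono) auto
    then show "inf ?x ?v \<le> 0"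
      by (simp only: disj)
  qed (simp add: assms)
  \<comment> \<open>Disjoint elements add up to their supremum, so two of them below
    \<open>d\<close> have a sum below \<open>d\<close>.\<close>
  then have "?x + ?v = sup ?x ?v"
    using add_eq_inf_sup[of ?x ?v] by simp
  also have "\<dots> \<le> d"
    by simp
  finally have "?x \<le> d - ?v"
    by (simp only: le_diff_eq)
  also have "d - ?v = sup (d - sup (c - a) 0) 0"
    by (simp only: diff_inf_eq_sup add_sup_distrib_left add_uminus_conv_diff diff_self)
  also have "\<dots> \<le> inf (sup (a - (c - d)) 0) d"
  proof -
    have "d - sup (c - a) 0 \<le> d - (c - a)" "d - sup (c - a) 0 \<le> d"
      by (simp_all add: diff_le_eq)
    moreover have "d - (c - a) = a - (c - d)"
      by simp
    ultimately show ?thesis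
      using assms(1) by (simp add: le_supI1)
  qed
  finally show ?thesis .
qed

text \<open>Each slice of \<open>b\<close> above the bottom one is at most the slice of
  \<open>a\<close> one level lower, hence \<open>Suc n\<close> against \<open>n\<close>. The bottom
  slice of \<open>b\<close> costs the extra \<open>d\<close>.\<close>

lemma inf_le_add_mesh:
  fixes a b d :: "'a::riesz_space"
  assumes "0 \<le> a" "0 \<le> d"
    and disj: "\<And>n. inf (sup (b - real n *\<^sub>R d) 0) (sup (real n *\<^sub>R d - a) 0) = 0"
  shows "inf b (real (Suc n) *\<^sub>R d) \<le> inf a (real n *\<^sub>R d) + d"
proof (induction n)
  case 0
  then show ?case
    using assms(1) by (simp add: inf.absorb2)
next
  case (Suc n)
  have step: "real (Suc k) *\<^sub>R d = real k *\<^sub>R d + d" for k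
    by (simp add: scaleR_left_distrib)
  let ?c = "real (Suc n) *\<^sub>R d"
  have "inf b (real (Suc (Suc n)) *\<^sub>R d) = inf b ?c + inf (sup (b - ?c) 0) d"
    unfolding step[of "Suc n"] by (rule slice_eq_diff_inf[OF assms(2), symmetric])
  also have "\<dots> \<le> (inf a (real n *\<^sub>R d) + d) + inf (sup (a - (?c - d)) 0) d"
    by (rule add_mono[OF Suc slice_le_slice[OF assms(2) disj]])
  also have "\<dots> = (inf a (real n *\<^sub>R d) + inf (sup (a - real n *\<^sub>R d) 0) d) + d"
    by (simp add: step add.assoc add.commute add.left_commute del: of_nat_Suc)
  also have "\<dots> = inf a ?c + d"
    unfolding step by (simp only: slice_eq_diff_inf[OF assms(2)])
  finally show ?case .
qed

lemma weak_order_unit_inf_le_imp_le: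
  fixes a b e :: "'a::dedekind_complete_riesz_space"
  assumes e: "weak_order_unit e" and b: "0 \<le> b"
    and le: "\<And>n. inf b (real n *\<^sub>R e) \<le> a"
  shows "b \<le> a"
proof -
  define w where "w = sup (b - a) 0"
  define y where "y = inf w e"
  have "y \<le> e" "y \<le> w"
    by (simp_all add: y_def)
  \<comment> \<open>If \<open>n y\<close> is below \<open>b\<close>, it is below
    \<open>inf b (n e)\<close> as well, and \<open>y\<close>, being at most \<open>w\<close>, fits
    into the gap between that infimum and \<open>b\<close>.\<close>
  have "real n *\<^sub>R y \<le> b" for n
  proof (induction n)
    case 0
    then show ?case using b by simp
  next
    case (Suc n)
    have "real n *\<^sub>R y \<le> real n *\<^sub>R e"
      using \<open>y \<le> e\<close> by (simp add: scaleR_left_mono)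
    then have "real n *\<^sub>R y \<le> inf b (real n *\<^sub>R e)"
      using Suc by simp
    moreover have "w \<le> b - inf b (real n *\<^sub>R e)"
      unfolding w_def
    proof (rule sup_least)
      show "b - a \<le> b - inf b (real n *\<^sub>R e)"
        by (rule diff_left_mono[OF le])
      show "0 \<le> b - inf b (real n *\<^sub>R e)"
        by (simp only: diff_ge_0_iff_ge inf_le1)
    qed
    ultimately have "real n *\<^sub>R y + y \<le> inf b (real n *\<^sub>R e) + (b - inf b (real n *\<^sub>R e))"
      using \<open>y \<le> w\<close> by (intro add_mono) auto
    then have "real n *\<^sub>R y + y \<le> b"
      by (simp only: add_diff_eq add_diff_cancel_left')
    then show ?case
      by (simp add: scaleR_left_distrib add.commute)
  qed
  then have "y \<le> 0"
    by (rule scaleR_bounded_imp_nonpos)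
  moreover have "0 \<le> w" "0 \<le> y"
    using e by (simp_all add: w_def y_def weak_order_unit_def)
  ultimately have "inf \<bar>w\<bar> e = 0"
    by (simp add: y_def order.antisym)
  then have "w = 0"
    using e by (simp add: weak_order_unit_def)
  then show ?thesis
    by (metis w_def diff_le_0_iff_le sup_ge1)
qed

lemma strictly_positive_mono:
  assumes "linear T" "strictly_positive T" "x \<le> y"
  shows "T x \<le> T y"
proof -
  have "0 \<le> T (y - x)"
    using assms by (simp add: strictly_positive_def)
  then show ?thesis
    by (simp add: linear_diff[OF assms(1)])
qed

lemma strictly_positive_eqI:
  assumes "linear T" "strictly_positive T" "x \<le> y" "T x = T y"
  shows "x = y"
proof (rule ccontr)
  assume "x \<noteq> y"
  then have "0 < T (y - x)"
    using assms by (simp add: strictly_positive_def)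
  then show False
    by (simp add: linear_diff[OF assms(1)] assms(4))
qed

text \<open>Positivity gives \<open>sup x y\<close> below its image, and by idempotence
  \<open>T\<close> agrees on the two; strict positivity then excludes a gap.\<close>

lemma strictly_positive_idem_sup_fixed:
  assumes T: "linear T" "strictly_positive T" and idem: "\<And>x. T (T x) = T x"
    and "T x = x" "T y = y"
  shows "T (sup x y) = sup x y"
proof -
  have "sup x y \<le> T (sup x y)"
    using strictly_positive_mono[OF T, of x "sup x y"] strictly_positive_mono[OF T, of y "sup x y"]
      assms(4,5) by simp
  then show ?thesis
    using strictly_positive_eqI[OF T, of "sup x y" "T (sup x y)"] idem by simp
qed

lemma fixed_disjoint_imp_disjoint_image:
  assumes T: "linear T" "strictly_positive T"
    and "\<And>x. T (S x) = T x" and "T u = u" "T v = v" "inf u v = 0" "0 \<le> u" "0 \<le> S v"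
  shows "inf u (S v) = 0"
proof -
  have "T (inf u (S v)) \<le> inf u v"
    using strictly_positive_mono[OF T, of "inf u (S v)" u]
      strictly_positive_mono[OF T, of "inf u (S v)" "S v"] assms(3-5) by simp
  moreover have "0 \<le> T (inf u (S v))"
    using assms by (simp add: strictly_positive_def)
  ultimately have "T (inf u (S v)) = T 0"
    using assms(6) by (simp add: linear_0[OF T(1)])
  then show ?thesis
    using strictly_positive_eqI[OF T, of 0 "inf u (S v)"] assms(7,8) by simp
qed

lemma riesz_homomorphism_fixed_nonneg:
  fixes T S :: "'a::dedekind_complete_riesz_space \<Rightarrow> 'a"
  assumes sys: "conditional_expectation_preserving_system T S e"
    and f: "0 \<le> f" "T f = f"
  shows "S f = f"
proof -
  have e: "weak_order_unit e" "T e = e" "S e = e"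
    and T: "linear T" "strictly_positive T" and "T \<circ> T = T"
    and S: "linear S" "\<And>x y. S (sup x y) = sup (S x) (S y)"
    and TS: "\<And>x. T (S x) = T x"
    using sys by (auto simp: conditional_expectation_preserving_system_def
        conditional_riesz_triple_def conditional_expectation_operator_def riesz_homomorphism_def)
  have idem: "T (T x) = T x" for x
    using \<open>T \<circ> T = T\<close> by (metis comp_apply)
  have T_pos: "T (sup x 0) = sup x 0" if "T x = x" for x
    using strictly_positive_idem_sup_fixed[OF T idem that] by (simp add: linear_0[OF T(1)])
  have S_pos: "S (sup x 0) = sup (S x) 0" for x
    by (simp add: S(2) linear_0[OF S(1)])
  have e0: "0 \<le> e"
    using e(1) by (simp add: weak_order_unit_def)
  have Sf: "0 \<le> S f"
    using S_pos[of f] f(1) by (metis sup.absorb1 sup.cobounded2)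
  \<comment> \<open>Both parts of \<open>f - c e\<close> are fixed by \<open>T\<close>. As
    \<open>S\<close> fixes \<open>e\<close>, it sends the positive part to that of
    \<open>S f - c e\<close>.\<close>
  have disj: "inf (sup (S f - c *\<^sub>R e) 0) (sup (c *\<^sub>R e - f) 0) = 0" for c
  proof -
    let ?u = "sup (c *\<^sub>R e - f) 0" and ?v = "sup (f - c *\<^sub>R e) 0"
    have "T (c *\<^sub>R e - f) = c *\<^sub>R e - f" "T (f - c *\<^sub>R e) = f - c *\<^sub>R e"
      using e f by (simp_all add: linear_diff[OF T(1)] linear_scale[OF T(1)])
    note fixed = this[THEN T_pos]
    have "S ?v = sup (S f - c *\<^sub>R e) 0"
      using e by (simp add: S_pos linear_diff[OF S(1)] linear_scale[OF S(1)])
    moreover have "inf ?u ?v = 0"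
    proof -
      have "?v = ?u + (f - c *\<^sub>R e)"
        by (simp add: add_sup_distrib_right sup_commute)
      then have "inf ?u ?v = ?u + inf 0 (f - c *\<^sub>R e)"
        by (simp add: add_inf_distrib_left)
      also have "inf 0 (f - c *\<^sub>R e) = - ?u"
        by (simp add: neg_sup_eq_inf inf_commute)
      finally show ?thesis
        by (simp only: add.right_inverse)
    qed
    ultimately show ?thesis
      using fixed_disjoint_imp_disjoint_image[OF T TS fixed] by (simp add: inf_commute)
  qed
  have "S f \<le> f"
  proof (rule weak_order_unit_inf_le_imp_le[OF e(1) Sf])
    fix k :: nat
    have "inf (S f) (real k *\<^sub>R e) - f \<le> 0"
    proof (rule scaleR_bounded_imp_nonpos)
      fix m :: nat
      show "real m *\<^sub>R (inf (S f) (real k *\<^sub>R e) - f) \<le> e"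
      proof (cases "m = 0")
        case False
        \<comment> \<open>With mesh \<open>e / m\<close>, an error of one mesh step becomes exactly
          \<open>e\<close> after scaling by \<open>m\<close>.\<close>
        define d where "d = (1 / real m) *\<^sub>R e"
        have d0: "0 \<le> d"
          using e0 by (simp add: d_def scaleR_nonneg_nonneg)
        have md: "real m *\<^sub>R d = e"
          using False by (simp add: d_def)
        \<comment> \<open>The level \<open>k e\<close> is reached after \<open>k * m\<close> mesh
          steps; one more step matches the form of \<open>inf_le_add_mesh\<close>.\<close>
        have "real k *\<^sub>R e = real (k * m) *\<^sub>R d"
          by (simp flip: md)
        also have "\<dots> \<le> real (Suc (k * m)) *\<^sub>R d"
          using d0 by (intro scaleR_right_mono) auto
        finally have "inf (S f) (real k *\<^sub>R e) \<le> inf (S f) (real (Suc (k * m)) *\<^sub>R d)"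
          by (rule inf_mono[OF order_refl])
        also have "\<dots> \<le> inf f (real (k * m) *\<^sub>R d) + d"
          using disj by (intro inf_le_add_mesh[OF f(1) d0]) (simp add: d_def)
        also have "\<dots> \<le> f + d"
          by simp
        finally have "inf (S f) (real k *\<^sub>R e) - f \<le> d"
          by (simp add: diff_le_eq add.commute)
        then have "real m *\<^sub>R (inf (S f) (real k *\<^sub>R e) - f) \<le> real m *\<^sub>R d"
          by (simp add: scaleR_left_mono)
        then show ?thesis
          by (simp only: md)
      qed (simp add: e0)
    qed
    then show "inf (S f) (real k *\<^sub>R e) \<le> f"
      by simp
  qed
  then show ?thesis
    by (rule strictly_positive_eqI[OF T _ TS])
qed

theorem lemma3:
  fixes T S :: "'a::dedekind_complete_riesz_space \<Rightarrow> 'a" and e :: 'a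
  assumes "conditional_expectation_preserving_system T S e"
  shows "\<forall>f\<in>range T. S f = f"
proof
  fix f assume "f \<in> range T"
  have T: "linear T" "strictly_positive T" and "T \<circ> T = T" and S: "linear S"
    using assms by (auto simp: conditional_expectation_preserving_system_def
        conditional_riesz_triple_def conditional_expectation_operator_def riesz_homomorphism_def)
  have idem: "T (T x) = T x" for x
    using \<open>T \<circ> T = T\<close> by (metis comp_apply)
  have "T f = f"
    using \<open>f \<in> range T\<close> idem by auto
  then have fixed: "T (sup f 0) = sup f 0"
    using strictly_positive_idem_sup_fixed[OF T idem, of f 0] by (simp add: linear_0[OF T(1)])
  have "S (sup f 0) = sup f 0"
    using fixed by (intro riesz_homomorphism_fixed_nonneg[OF assms]) auto
  \<comment> \<open>\<open>sup f 0 - f\<close> is the negative part of \<open>f\<close>; subtracting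
    it from the positive part recovers \<open>f\<close>.\<close>
  moreover have "S (sup f 0 - f) = sup f 0 - f"
    using fixed \<open>T f = f\<close>
    by (intro riesz_homomorphism_fixed_nonneg[OF assms]) (simp_all add: linear_diff[OF T(1)])
  ultimately show "S f = f"
    by (simp add: linear_diff[OF S])
qed

end
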